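(* Let $S$ be a reduced information semialgebra. The following statements are equivalent. (a) $U_n(S)$ is an FFM for every integer $n\ge 2$. (b) $U_n(S)$ is an FFM for some integer $n\ge 2$. (c) $(S,+)$ is an FFM.
   Context: All monoids are cancellative but not necessarily commutative. An information semialgebra is a semiring $S$ with $0$ and $1$ (so $(S,+)$ is a commutative monoid with identity $0$, multiplication has identity $1$ and distributes over addition, and $0\cdot x=0$ for all $x$) such that $(S,+)$ is a cancellative commutative monoid whose only invertible element is $0$, and $(S\setminus\{0\},\cdot)$ is a cancellative commutative monoid. $S$ is reduced if $1$ is the only invertible element of $(S\setminus\{0\},\cdot)$. $U_n(S)$ is the multiplicative monoid of $n\times n$ upper triangular matrices over $S$ all of whose diagonal entries equal $1$. In a monoid $M$, an atom is a non-invertible $a$ such that $a=uv$ implies that $u$ or $v$ is invertible; $M$ is atomic if each non-invertible element is a finite product of atoms. If the identity is the only invertible element of $M$ (as is the case for all monoids in the claim), $M$ is an FFM (finite factorization monoid) if it is atomic and for every $x\in M$ there are only finitely many finite sequences of atoms $(a_1,\dots,a_\ell)$ with $a_1\cdots a_\ell=x$ (rigid factorizations; for commutative $M$ this is equivalent to finiteness of the number of factorizations up to order). *)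

theory Defs
  imports "Jordan_Normal_Form.Matrix"
begin

text \<open>Additive cancellation is taken from \<open>cancel_semigroup_add\<close> because
  \<open>cancel_comm_monoid_add\<close> would require a subtraction operation on \<open>S\<close>.  The superclass
  \<open>semiring_no_zero_divisors_cancel\<close> together with \<open>0 \<noteq> 1\<close> says that the nonzero elements form
  a cancellative multiplicative monoid.\<close>

class information_semialgebra =
  comm_semiring_1 + cancel_semigroup_add + semiring_no_zero_divisors_cancel +
  assumes add_eq_0_imp_eq_0: "a + b = 0 \<Longrightarrow> a = 0"

definition reduced_semialgebra :: "'a::information_semialgebra itself \<Rightarrow> bool" where
  "reduced_semialgebra _ \<longleftrightarrow> (\<forall>x::'a. x dvd 1 \<longrightarrow> x = 1)"

definition additive_monoid :: "'a::comm_monoid_add itself \<Rightarrow> 'a monoid" where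
  "additive_monoid _ = \<lparr>carrier = UNIV, mult = (+), one = 0\<rparr>"

definition unitriangular_monoid :: "'a::comm_semiring_1 itself \<Rightarrow> nat \<Rightarrow> 'a mat monoid" where
  "unitriangular_monoid _ n =
    \<lparr>carrier = {A \<in> carrier_mat n n. upper_triangular A \<and> (\<forall>i<n. A $$ (i, i) = 1)},
     mult = (*), one = 1\<^sub>m n\<rparr>"

text \<open>The library predicate \<open>irreducible\<close> is phrased through one-sided divisibility and is meant
  for commutative monoids; the notion below is the one for arbitrary monoids.\<close>

definition atom :: "('a, 'b) monoid_scheme \<Rightarrow> 'a \<Rightarrow> bool" where
  "atom M a \<longleftrightarrow> a \<in> carrier M \<and> a \<notin> Units M \<and>
    (\<forall>u\<in>carrier M. \<forall>v\<in>carrier M. a = u \<otimes>\<^bsub>M\<^esub> v \<longrightarrow> u \<in> Units M \<or> v \<in> Units M)"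

definition atom_factorizations :: "('a, 'b) monoid_scheme \<Rightarrow> 'a \<Rightarrow> 'a list set" where
  "atom_factorizations M x =
    {as. (\<forall>a\<in>set as. atom M a) \<and> foldr (\<otimes>\<^bsub>M\<^esub>) as \<one>\<^bsub>M\<^esub> = x}"

definition atomic :: "('a, 'b) monoid_scheme \<Rightarrow> bool" where
  "atomic M \<longleftrightarrow> (\<forall>x\<in>carrier M. x \<notin> Units M \<longrightarrow> atom_factorizations M x \<noteq> {})"

text \<open>Counting sequences of atoms, with no identification up to units, is the right notion of
  finite factorization only for monoids whose sole unit is the identity.  The monoids
  \<^term>\<open>additive_monoid TYPE('a::information_semialgebra)\<close> and
  \<^term>\<open>unitriangular_monoid TYPE('a::information_semialgebra) n\<close> have this property.\<close>

definition FFM :: "('a, 'b) monoid_scheme \<Rightarrow> bool" where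
  "FFM M \<longleftrightarrow> atomic M \<and> (\<forall>x\<in>carrier M. finite (atom_factorizations M x))"

end

theory Submission
  imports Defs
begin

text \<open>In a monoid whose only unit is the identity, being an FFM means that every element has only
  finitely many factorizations into non-identity elements: refining such factorizations into atoms
  gives one direction, and a factorization of maximal length consists of atoms.  This criterion
  passes to submonoids, and \<open>(S,+)\<close> embeds into the unitriangular matrices.  Conversely the
  \<open>(i,j)\<close> entry of a product of unitriangular matrices is the sum of the \<open>(i,j)\<close> entries
  of the factors plus a remainder, so an FFM \<open>(S,+)\<close> bounds both the entries and the number of
  the factors.\<close>

section \<open>Factorizations into non-identity elements\<close>

text \<open>Atoms of a submonoid may split in a larger monoid, whereas being different from the
  identity does not depend on the ambient monoid. This makes these factorizations easy to transport
  along injective homomorphisms.\<close>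

definition nontrivial_factorizations :: "('a, 'b) monoid_scheme \<Rightarrow> 'a \<Rightarrow> 'a list set" where
  "nontrivial_factorizations M x =
    {as. set as \<subseteq> carrier M - {\<one>\<^bsub>M\<^esub>} \<and> foldr (\<otimes>\<^bsub>M\<^esub>) as \<one>\<^bsub>M\<^esub> = x}"

lemma finite_lists_bounded:
  assumes "finite F"
  obtains N where "\<And>xs. xs \<in> F \<Longrightarrow> length xs \<le> N"
proof
  fix xs assume "xs \<in> F"
  then show "length xs \<le> Max (length ` F)" using assms by auto
qed

context monoid
begin

lemma foldr_mult_closed: "set as \<subseteq> carrier G \<Longrightarrow> foldr (\<otimes>) as \<one> \<in> carrier G"
  by (induction as) auto

lemma foldr_mult_append:
  assumes "set as \<subseteq> carrier G" "set bs \<subseteq> carrier G"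
  shows "foldr (\<otimes>) (as @ bs) \<one> = foldr (\<otimes>) as \<one> \<otimes> foldr (\<otimes>) bs \<one>"
  using assms by (induction as) (auto simp: foldr_mult_closed m_assoc simp del: foldr_append)

text \<open>This is the refinement step: later \<open>f\<close> picks a factorization into atoms for
  each factor.\<close>

lemma foldr_mult_concat:
  assumes "\<And>a. a \<in> set as \<Longrightarrow> set (f a) \<subseteq> carrier G \<and> foldr (\<otimes>) (f a) \<one> = a"
  shows "foldr (\<otimes>) (concat (map f as)) \<one> = foldr (\<otimes>) as \<one>"
  using assms
proof (induction as)
  case (Cons a as)
  have "set (concat (map f as)) \<subseteq> carrier G" using Cons.prems by auto
  then show ?case using Cons by (simp add: foldr_mult_append del: foldr_append)
qed simp

lemma atom_factorizations_subset: "atom_factorizations G x \<subseteq> nontrivial_factorizations G x"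
  by (auto simp: atom_factorizations_def nontrivial_factorizations_def atom_def)

lemma atomic_if_finite_nontrivial_factorizations:
  assumes units: "Units G = {\<one>}"
    and fin: "\<And>x. x \<in> carrier G \<Longrightarrow> finite (nontrivial_factorizations G x)"
  shows "atomic G"
  unfolding atomic_def
proof (intro ballI impI)
  fix x assume x: "x \<in> carrier G" "x \<notin> Units G"
  let ?F = "nontrivial_factorizations G x"
  have "[x] \<in> ?F"
    using x units by (auto simp: nontrivial_factorizations_def)
  obtain N where N: "\<And>xs. xs \<in> ?F \<Longrightarrow> length xs \<le> N"
    using finite_lists_bounded[OF fin[OF x(1)]] by blast
  \<comment> \<open>All lengths lie strictly below \<open>Suc N\<close>, and \<open>[x]\<close>
    shows that there is a factorization at all, so one of maximal length exists.\<close>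
  have "\<exists>as. as \<in> ?F \<and> (\<forall>bs. bs \<in> ?F \<longrightarrow> length bs \<le> length as)"
    by (rule ex_has_greatest_nat[of _ "[x]" _ "Suc N"])
      (use \<open>[x] \<in> ?F\<close> N in \<open>auto simp: less_Suc_eq_le\<close>)
  then obtain as where as: "as \<in> ?F" and maximal: "\<And>bs. bs \<in> ?F \<Longrightarrow> length bs \<le> length as"
    by blast
  have "atom G a" if a: "a \<in> set as" for a
    unfolding atom_def
  proof (intro conjI ballI impI)
    show a': "a \<in> carrier G" "a \<notin> Units G"
      using as a units by (auto simp: nontrivial_factorizations_def)
    fix u v assume uv: "u \<in> carrier G" "v \<in> carrier G" "a = u \<otimes> v"
    obtain bs cs where split: "as = bs @ a # cs" using a by (meson split_list)
    show "u \<in> Units G \<or> v \<in> Units G"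
    proof (rule ccontr)
      assume "\<not> ?thesis"
      moreover have "foldr (\<otimes>) cs \<one> \<in> carrier G"
        using as by (intro foldr_mult_closed) (auto simp: nontrivial_factorizations_def split)
      \<comment> \<open>Replacing \<open>a\<close> by two non-identity factors \<open>u\<close> and
        \<open>v\<close> gives a strictly longer factorization of \<open>x\<close>, against
        maximality.\<close>
      ultimately have "bs @ u # v # cs \<in> ?F"
        using as uv units by (auto simp: nontrivial_factorizations_def split m_assoc)
      then have "length (bs @ u # v # cs) \<le> length as" by (rule maximal)
      then show False by (simp add: split)
    qed
  qed
  then have "as \<in> atom_factorizations G x"
    using as by (auto simp: nontrivial_factorizations_def atom_factorizations_def)
  then show "atom_factorizations G x \<noteq> {}" by blast
qed

text \<open>Concatenating chosen atom factorizations of the factors gives an atom factorization of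
  \<open>x\<close>. As there are finitely many of those, both the number of factors and the set of
  possible factors are bounded.\<close>

lemma finite_nontrivial_factorizations_if_FFM:
  assumes units: "Units G = {\<one>}" and ffm: "FFM G" and x: "x \<in> carrier G"
  shows "finite (nontrivial_factorizations G x)"
proof -
  have "\<exists>as. as \<in> atom_factorizations G a" if "a \<in> carrier G - {\<one>}" for a
    using that ffm units by (auto simp: FFM_def atomic_def)
  then obtain f where f: "\<And>a. a \<in> carrier G - {\<one>} \<Longrightarrow> f a \<in> atom_factorizations G a"
    by metis
  let ?A = "atom_factorizations G x"
  have fin: "finite ?A" using ffm x by (simp add: FFM_def)
  obtain N where N: "\<And>xs. xs \<in> ?A \<Longrightarrow> length xs \<le> N"
    using finite_lists_bounded[OF fin] by blast
  \<comment> \<open>\<open>W\<close> consists of the short words in atoms that occur in some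
    factorization of \<open>x\<close>. It contains every \<open>f a\<close>, so the set
    \<open>D\<close> of their products contains every factor \<open>a\<close>.\<close>
  define W where "W = {ws. set ws \<subseteq> (\<Union>cs\<in>?A. set cs) \<and> length ws \<le> N}"
  define D where "D = (\<lambda>ws. foldr (\<otimes>) ws \<one>) ` W"
  have "finite D"
    unfolding D_def W_def using fin by (intro finite_imageI finite_lists_length_le) auto
  moreover have "set as \<subseteq> D \<and> length as \<le> N" if as: "as \<in> nontrivial_factorizations G x" for as
  proof -
    let ?cs = "concat (map f as)"
    have fa: "f a \<in> atom_factorizations G a" if "a \<in> set as" for a
      using f as that by (auto simp: nontrivial_factorizations_def)
    have ne: "f a \<noteq> []" if "a \<in> set as" for a
    proof
      assume "f a = []"
      then have "a = \<one>" using fa[OF that] by (auto simp: atom_factorizations_def)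
      then show False using as that by (auto simp: nontrivial_factorizations_def)
    qed
    have "foldr (\<otimes>) ?cs \<one> = x"
      using as fa
      by (subst foldr_mult_concat)
        (auto simp: nontrivial_factorizations_def atom_factorizations_def atom_def)
    then have cs: "?cs \<in> ?A"
      using fa by (auto simp: atom_factorizations_def)
    have len_fa: "length (f a) \<le> length ?cs" if "a \<in> set as" for a
      using that by (auto simp: length_concat comp_def intro: member_le_sum_list)
    have "f a \<in> W" if "a \<in> set as" for a
      using that cs N[OF cs] len_fa[OF that] unfolding W_def by fastforce
    then have "a \<in> D" if "a \<in> set as" for a
      using that fa[OF that] unfolding D_def
      by (force simp: atom_factorizations_def)
    moreover have "length as \<le> length ?cs"
    proof -
      \<comment> \<open>Each non-identity factor contributes at least one atom to
        \<open>?cs\<close>.\<close>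
      have "(\<Sum>a\<leftarrow>as. 1) \<le> (\<Sum>a\<leftarrow>as. length (f a))"
        using ne by (intro sum_list_mono) (simp add: Suc_le_eq)
      then show ?thesis by (simp add: length_concat comp_def sum_list_triv)
    qed
    ultimately show ?thesis using N[OF cs] by auto
  qed
  ultimately show ?thesis
    by (intro finite_subset[OF _ finite_lists_length_le[of D N]]) auto
qed

lemma FFM_iff_finite_nontrivial_factorizations:
  assumes "Units G = {\<one>}"
  shows "FFM G \<longleftrightarrow> (\<forall>x\<in>carrier G. finite (nontrivial_factorizations G x))"
proof
  assume "FFM G"
  then show "\<forall>x\<in>carrier G. finite (nontrivial_factorizations G x)"
    using finite_nontrivial_factorizations_if_FFM[OF assms] by blast
next
  assume fin: "\<forall>x\<in>carrier G. finite (nontrivial_factorizations G x)"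
  then have "atomic G"
    by (intro atomic_if_finite_nontrivial_factorizations[OF assms]) blast
  then show "FFM G"
    unfolding FFM_def using fin finite_subset[OF atom_factorizations_subset] by blast
qed

end

text \<open>Mapping \<open>h\<close> over a factorization of \<open>x\<close> gives one of
  \<open>h x\<close>: by injectivity no factor becomes the identity, and the original list can be
  recovered.\<close>

lemma finite_nontrivial_factorizations_inj_hom:
  assumes "monoid M" and inj: "inj_on h (carrier M)" and hom: "h \<in> hom M N"
    and one: "h \<one>\<^bsub>M\<^esub> = \<one>\<^bsub>N\<^esub>"
    and fin: "finite (nontrivial_factorizations N (h x))"
  shows "finite (nontrivial_factorizations M x)"
proof -
  interpret monoid M by fact
  have foldr_hom: "foldr (\<otimes>\<^bsub>N\<^esub>) (map h as) \<one>\<^bsub>N\<^esub> = h (foldr (\<otimes>\<^bsub>M\<^esub>) as \<one>\<^bsub>M\<^esub>)"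
    if "set as \<subseteq> carrier M" for as
    using that by (induction as) (auto simp: one hom_mult[OF hom] foldr_mult_closed)
  have ne: "h a \<noteq> \<one>\<^bsub>N\<^esub>" if "a \<in> carrier M" "a \<noteq> \<one>\<^bsub>M\<^esub>" for a
    using that inj one one_closed unfolding inj_on_def by metis
  have "map h ` nontrivial_factorizations M x \<subseteq> nontrivial_factorizations N (h x)"
    using ne hom_in_carrier[OF hom] foldr_hom by (auto simp: nontrivial_factorizations_def) blast+
  then have "finite (map h ` nontrivial_factorizations M x)"
    using fin finite_subset by blast
  moreover have "inj_on (map h) (nontrivial_factorizations M x)"
    by (rule inj_on_mapI, rule inj_on_subset[OF inj]) (auto simp: nontrivial_factorizations_def)
  ultimately show ?thesis using finite_imageD by blast
qed

section \<open>The additive monoid\<close>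

lemma monoid_additive_monoid: "monoid (additive_monoid TYPE('a::comm_monoid_add))"
  by unfold_locales (auto simp: additive_monoid_def add.assoc)

lemma Units_additive_monoid:
  "Units (additive_monoid TYPE('a::information_semialgebra)) = {\<one>\<^bsub>additive_monoid TYPE('a)\<^esub>}"
  by (auto simp: Units_def additive_monoid_def dest: add_eq_0_imp_eq_0)

lemma nontrivial_factorizations_additive_monoid:
  "nontrivial_factorizations (additive_monoid TYPE('a::comm_monoid_add)) x =
    {as. 0 \<notin> set as \<and> sum_list as = x}"
  by (auto simp: nontrivial_factorizations_def additive_monoid_def sum_list.eq_foldr)

section \<open>The monoid of unitriangular matrices\<close>

lemma unitriangular_monoid_sel [simp]:
  "carrier (unitriangular_monoid TYPE('a::comm_semiring_1) n) =
    {A \<in> carrier_mat n n. upper_triangular A \<and> (\<forall>i<n. A $$ (i, i) = 1)}"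
  "mult (unitriangular_monoid TYPE('a) n) = (*)"
  "one (unitriangular_monoid TYPE('a) n) = 1\<^sub>m n"
  by (simp_all add: unitriangular_monoid_def)

lemma index_mult_mat_sum:
  assumes "A \<in> carrier_mat n n" "B \<in> carrier_mat n n" "i < n" "j < n"
  shows "(A * B) $$ (i, j) = (\<Sum>k<n. A $$ (i, k) * B $$ (k, j))"
  using assms by (auto simp: scalar_prod_def atLeast0LessThan intro!: sum.cong)

lemma unitriangular_below_diag:
  fixes A :: "'a::comm_semiring_1 mat"
  assumes "A \<in> carrier (unitriangular_monoid TYPE('a) n)" "j < i" "i < n"
  shows "A $$ (i, j) = 0"
  using assms by (auto dest: upper_triangularD)

lemma unitriangular_mult_closed:
  fixes A B :: "'a::comm_semiring_1 mat"
  assumes A: "A \<in> carrier (unitriangular_monoid TYPE('a) n)"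
    and B: "B \<in> carrier (unitriangular_monoid TYPE('a) n)"
  shows "A * B \<in> carrier (unitriangular_monoid TYPE('a) n)"
proof -
  have "(A * B) $$ (i, j) = (if i = j then 1 else 0)" if "j \<le> i" "i < n" for i j
  proof -
    have "(A * B) $$ (i, j) = (\<Sum>k<n. A $$ (i, k) * B $$ (k, j))"
      using A B that by (intro index_mult_mat_sum) auto
    \<comment> \<open>On or below the diagonal only \<open>k = i\<close> survives: for
      \<open>k < i\<close> the entry of \<open>A\<close> vanishes, and for \<open>k > i\<close>,
      hence \<open>k > j\<close>, that of \<open>B\<close> does.\<close>
    also have "\<dots> = (\<Sum>k<n. if k = i then (if i = j then 1 else 0) else 0)"
    proof (rule sum.cong)
      fix k assume "k \<in> {..<n}"
      then show "A $$ (i, k) * B $$ (k, j) = (if k = i then (if i = j then 1 else 0) else 0)"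
        using A B that unitriangular_below_diag[OF A, of k i] unitriangular_below_diag[OF B, of j k]
        by (cases k i rule: linorder_cases) auto
    qed simp
    finally show ?thesis using that by simp
  qed
  then show ?thesis using A B by (auto intro!: upper_triangularI)
qed

lemma monoid_unitriangular_monoid: "monoid (unitriangular_monoid TYPE('a::comm_semiring_1) n)"
proof
  fix A B C :: "'a mat"
  let ?M = "unitriangular_monoid TYPE('a) n"
  show "A \<otimes>\<^bsub>?M\<^esub> B \<in> carrier ?M" if "A \<in> carrier ?M" "B \<in> carrier ?M"
    using unitriangular_mult_closed[OF that] by simp
  show "A \<otimes>\<^bsub>?M\<^esub> B \<otimes>\<^bsub>?M\<^esub> C = A \<otimes>\<^bsub>?M\<^esub> (B \<otimes>\<^bsub>?M\<^esub> C)"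
    if "A \<in> carrier ?M" "B \<in> carrier ?M" "C \<in> carrier ?M"
    using that by (auto intro!: assoc_mult_mat)
qed auto

text \<open>Since the diagonals are 1, the summands for \<open>k = j\<close> and
  \<open>k = i\<close> are the entries of \<open>A\<close> and \<open>B\<close>; the remaining
  summands make up \<open>c\<close>.\<close>

lemma unitriangular_mult_index:
  fixes A B :: "'a::comm_semiring_1 mat"
  assumes A: "A \<in> carrier (unitriangular_monoid TYPE('a) n)"
    and B: "B \<in> carrier (unitriangular_monoid TYPE('a) n)"
    and ij: "i < j" "j < n"
  obtains c where "(A * B) $$ (i, j) = A $$ (i, j) + B $$ (i, j) + c"
proof
  let ?t = "\<lambda>k. A $$ (i, k) * B $$ (k, j)"
  have "(A * B) $$ (i, j) = (\<Sum>k<n. ?t k)"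
    using A B ij by (intro index_mult_mat_sum) auto
  also have "\<dots> = ?t j + (?t i + sum ?t ({..<n} - {j} - {i}))"
    using ij by (subst sum.remove[of _ j], simp, simp, subst sum.remove[of _ i], auto)
  finally show "(A * B) $$ (i, j) = A $$ (i, j) + B $$ (i, j) + sum ?t ({..<n} - {j} - {i})"
    using A B ij by (simp add: add.assoc)
qed

text \<open>If \<open>A * B\<close> is the identity, each entry of \<open>A\<close> above the
  diagonal is a summand of 0, hence 0.\<close>

lemma Units_unitriangular_monoid:
  "Units (unitriangular_monoid TYPE('a::information_semialgebra) n) =
    {\<one>\<^bsub>unitriangular_monoid TYPE('a) n\<^esub>}"
proof -
  let ?M = "unitriangular_monoid TYPE('a) n"
  interpret monoid ?M by (rule monoid_unitriangular_monoid)
  have "A = 1\<^sub>m n" if A: "A \<in> carrier ?M" and B: "B \<in> carrier ?M" and AB: "A * B = 1\<^sub>m n" for A B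
  proof (rule eq_matI)
    fix i j assume "i < dim_row (1\<^sub>m n :: 'a mat)" "j < dim_col (1\<^sub>m n :: 'a mat)"
    then have ij: "i < n" "j < n" by auto
    show "A $$ (i, j) = 1\<^sub>m n $$ (i, j)"
    proof (cases i j rule: linorder_cases)
      case less
      obtain c where "(A * B) $$ (i, j) = A $$ (i, j) + B $$ (i, j) + c"
        using unitriangular_mult_index[OF A B less ij(2)] .
      then have "A $$ (i, j) + (B $$ (i, j) + c) = 0"
        using AB ij less by (simp add: add.assoc)
      then show ?thesis using ij less by (auto dest: add_eq_0_imp_eq_0)
    qed (use A ij in auto)
  qed (use A in auto)
  then show ?thesis using Units_one_closed unfolding Units_def by auto
qed

text \<open>It supplies a nonzero entry above the diagonal for each non-identity factor, which
  allows factors to be counted by positions.\<close>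

lemma unitriangular_eq_one_iff:
  fixes A :: "'a::comm_semiring_1 mat"
  assumes "A \<in> carrier (unitriangular_monoid TYPE('a) n)"
  shows "A = 1\<^sub>m n \<longleftrightarrow> (\<forall>i j. i < j \<and> j < n \<longrightarrow> A $$ (i, j) = 0)"
proof
  assume zero: "\<forall>i j. i < j \<and> j < n \<longrightarrow> A $$ (i, j) = 0"
  show "A = 1\<^sub>m n"
  proof (rule eq_matI)
    fix i j assume "i < dim_row (1\<^sub>m n :: 'a mat)" "j < dim_col (1\<^sub>m n :: 'a mat)"
    then show "A $$ (i, j) = 1\<^sub>m n $$ (i, j)"
      using assms zero by (cases i j rule: linorder_cases) auto
  qed (use assms in auto)
qed simp

section \<open>Bounding factorizations of a unitriangular matrix\<close>

text \<open>The remainders of the successive products accumulate in \<open>c\<close>. Thus a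
  factorization of a matrix induces an additive decomposition of each of its entries above the
  diagonal.\<close>

lemma unitriangular_foldr_index:
  fixes As :: "'a::comm_semiring_1 mat list"
  assumes "set As \<subseteq> carrier (unitriangular_monoid TYPE('a) n)" and ij: "i < j" "j < n"
  shows "\<exists>c. foldr (*) As (1\<^sub>m n) $$ (i, j) = (\<Sum>A\<leftarrow>As. A $$ (i, j)) + c"
  using assms(1)
proof (induction As)
  case Nil
  then show ?case using ij by simp
next
  case (Cons A As)
  interpret monoid "unitriangular_monoid TYPE('a) n" by (rule monoid_unitriangular_monoid)
  let ?P = "foldr (*) As (1\<^sub>m n)"
  have "?P \<in> carrier (unitriangular_monoid TYPE('a) n)"
    using foldr_mult_closed[of As] Cons.prems by simp
  then obtain c where "(A * ?P) $$ (i, j) = A $$ (i, j) + ?P $$ (i, j) + c"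
    using unitriangular_mult_index[of A n ?P i j] Cons.prems ij by auto
  moreover obtain d where "?P $$ (i, j) = (\<Sum>A\<leftarrow>As. A $$ (i, j)) + d"
    using Cons by auto
  ultimately show ?case by (auto simp: add.assoc)
qed

lemma sum_list_filter_nonzero:
  "sum_list (filter (\<lambda>x. x \<noteq> 0) xs) = sum_list (xs :: 'a::comm_monoid_add list)"
  by (induction xs) auto

lemma finite_matrices_with_entries:
  assumes "\<And>i j. i < n \<Longrightarrow> j < n \<Longrightarrow> finite (D i j)"
  shows "finite {A \<in> carrier_mat n n. \<forall>i<n. \<forall>j<n. A $$ (i, j) \<in> D i j}"
proof (rule finite_subset)
  let ?P = "{..<n} \<times> {..<n}"
  show "finite ((\<lambda>f. mat n n f) ` PiE ?P (\<lambda>(i, j). D i j))"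
    using assms by (intro finite_imageI finite_PiE) auto
  show "{A \<in> carrier_mat n n. \<forall>i<n. \<forall>j<n. A $$ (i, j) \<in> D i j}
    \<subseteq> (\<lambda>f. mat n n f) ` PiE ?P (\<lambda>(i, j). D i j)"
  proof
    fix A assume A: "A \<in> {A \<in> carrier_mat n n. \<forall>i<n. \<forall>j<n. A $$ (i, j) \<in> D i j}"
    \<comment> \<open>The restriction makes the index function extensional, as membership in
      \<open>PiE\<close> demands.\<close>
    have "A = mat n n (restrict (\<lambda>ij. A $$ ij) ?P)" using A by auto
    moreover have "restrict (\<lambda>ij. A $$ ij) ?P \<in> PiE ?P (\<lambda>(i, j). D i j)"
      using A by (auto simp: PiE_iff)
    ultimately show "A \<in> (\<lambda>f. mat n n f) ` PiE ?P (\<lambda>(i, j). D i j)" by blast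
  qed
qed

text \<open>Every list element is counted at least once on the right. With \<open>p\<close> a matrix
  position and \<open>Q p\<close> saying that the entry there is nonzero, bounds per position yield
  a bound on the number of factors.\<close>

lemma length_le_sum_length_filter:
  assumes "finite P" and "\<And>x. x \<in> set xs \<Longrightarrow> \<exists>p\<in>P. Q p x"
  shows "length xs \<le> (\<Sum>p\<in>P. length (filter (Q p) xs))"
  using assms(2)
proof (induction xs)
  case (Cons x xs)
  obtain p where p: "p \<in> P" "Q p x" using Cons.prems by auto
  have "(\<Sum>p\<in>P. length (filter (Q p) xs)) < (\<Sum>p\<in>P. length (filter (Q p) (x # xs)))"
    using assms(1) p by (intro sum_strict_mono_ex1) auto
  then show ?case using Cons by fastforce
qed simp

lemma finite_nontrivial_factorizations_unitriangular:
  fixes X :: "'a::comm_semiring_1 mat"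
  assumes fin: "\<And>x::'a. finite {as. 0 \<notin> set as \<and> sum_list as = x}"
  shows "finite (nontrivial_factorizations (unitriangular_monoid TYPE('a) n) X)"
proof -
  let ?M = "unitriangular_monoid TYPE('a) n"
  define F where "F x = {as::'a list. 0 \<notin> set as \<and> sum_list as = x}" for x
  have "\<exists>N. \<forall>as\<in>F x. length as \<le> N" for x
    using finite_lists_bounded[of "F x"] fin unfolding F_def by metis
  then obtain L where L: "\<And>x as. as \<in> F x \<Longrightarrow> length as \<le> L x" by metis
  define P where "P = {(i, j). i < j \<and> j < n}"
  have finP: "finite P"
    by (rule finite_subset[of _ "{..<n} \<times> {..<n}"]) (auto simp: P_def)
  define N where "N = (\<Sum>(i, j)\<in>P. L (X $$ (i, j)))"
  \<comment> \<open>The value 1 accounts for the diagonal, and 0 for the entries below it and for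
    vanishing entries above it; all other entries occur in an additive factorization of
    \<open>x\<close>.\<close>
  define E where "E x = {0, 1} \<union> \<Union> (set ` F x)" for x
  have finE: "finite (E x)" for x using fin by (auto simp: E_def F_def)
  define D where "D = {A \<in> carrier_mat n n. \<forall>i<n. \<forall>j<n. A $$ (i, j) \<in> E (X $$ (i, j))}"
  have "finite D" unfolding D_def by (rule finite_matrices_with_entries) (rule finE)
  moreover have "set As \<subseteq> D \<and> length As \<le> N" if As: "As \<in> nontrivial_factorizations ?M X" for As
  proof -
    have carr: "set As \<subseteq> carrier ?M" and ne: "\<And>A. A \<in> set As \<Longrightarrow> A \<noteq> 1\<^sub>m n"
      and prod: "foldr (*) As (1\<^sub>m n) = X"
      using As by (auto simp: nontrivial_factorizations_def)
    define ys where "ys p = filter (\<lambda>x. x \<noteq> 0) (map (\<lambda>A. A $$ p) As)" for p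
    have ys: "\<exists>zs. ys (i, j) @ zs \<in> F (X $$ (i, j))" if ij: "i < j" "j < n" for i j
    proof -
      obtain c where "X $$ (i, j) = sum_list (ys (i, j)) + c"
        using unitriangular_foldr_index[OF carr ij] unfolding ys_def sum_list_filter_nonzero prod by auto
      \<comment> \<open>The filter appends the remainder \<open>c\<close> only if it is nonzero, as
        \<open>F\<close> admits no zero summands.\<close>
      then have "ys (i, j) @ filter (\<lambda>x. x \<noteq> 0) [c] \<in> F (X $$ (i, j))"
        by (auto simp: F_def ys_def)
      then show ?thesis by blast
    qed
    have "A \<in> D" if A: "A \<in> set As" for A
    proof -
      have "A $$ (i, j) \<in> E (X $$ (i, j))" if ij: "i < n" "j < n" for i j
      proof (cases i j rule: linorder_cases)
        case less
        obtain zs where zs: "ys (i, j) @ zs \<in> F (X $$ (i, j))" using ys[OF less ij(2)] by blast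
        have "A $$ (i, j) = 0 \<or> A $$ (i, j) \<in> set (ys (i, j) @ zs)" using A by (auto simp: ys_def)
        then show ?thesis using zs unfolding E_def by blast
      next
        case greater
        then have "A $$ (i, j) = 0" using carr A ij by (intro unitriangular_below_diag) auto
        then show ?thesis by (simp add: E_def)
      qed (use carr A ij in \<open>auto simp: E_def\<close>)
      then show ?thesis using carr A by (auto simp: D_def)
    qed
    moreover have "length As \<le> (\<Sum>p\<in>P. length (filter (\<lambda>A. A $$ p \<noteq> 0) As))"
    proof (rule length_le_sum_length_filter[OF finP])
      fix A assume "A \<in> set As"
      then show "\<exists>p\<in>P. A $$ p \<noteq> 0"
        using unitriangular_eq_one_iff[of A n] carr ne[of A] unfolding P_def by blast
    qed
    moreover have "\<dots> \<le> N"
      unfolding N_def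
    proof (rule sum_mono, clarify)
      fix i j assume "(i, j) \<in> P"
      then obtain zs where "ys (i, j) @ zs \<in> F (X $$ (i, j))" using ys unfolding P_def by blast
      from L[OF this] show "length (filter (\<lambda>A. A $$ (i, j) \<noteq> 0) As) \<le> L (X $$ (i, j))"
        by (simp add: ys_def filter_map comp_def)
    qed
    ultimately show ?thesis by auto
  qed
  ultimately show ?thesis
    by (intro finite_subset[OF _ finite_lists_length_le[of D N]]) auto
qed

section \<open>Embedding the additive monoid\<close>

text \<open>This is the identity plus \<open>x\<close> at position \<open>(0, 1)\<close>. Each
  summand tests the column index \<open>j\<close> outermost, so that sums over it collapse to single
  terms.\<close>

definition transvection :: "nat \<Rightarrow> 'a \<Rightarrow> 'a::comm_semiring_1 mat" where
  "transvection n x =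
    mat n n (\<lambda>(i, j). (if j = i then 1 else 0) + (if j = 1 then if i = 0 then x else 0 else 0))"

text \<open>The matrix unit \<open>E\<close> at \<open>(0, 1)\<close> squares to zero, so
  \<open>(1 + x E) (1 + y E) = 1 + (x + y) E\<close>.\<close>

lemma transvection_mult:
  assumes "n \<ge> 2"
  shows "transvection n x * transvection n y = transvection n (x + y)"
proof (rule eq_matI)
  fix i j assume "i < dim_row (transvection n (x + y))" "j < dim_col (transvection n (x + y))"
  then have ij: "i < n" "j < n" by (auto simp: transvection_def)
  let ?y = "\<lambda>k. transvection n y $$ (k, j)"
  have "(transvection n x * transvection n y) $$ (i, j) = (\<Sum>k<n. transvection n x $$ (i, k) * ?y k)"
    using ij by (intro index_mult_mat_sum) (auto simp: transvection_def)
  also have "\<dots> = (\<Sum>k<n. (if k = i then ?y k else 0) + (if k = 1 then if i = 0 then x * ?y k else 0 else 0))"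
    using ij by (intro sum.cong) (auto simp: transvection_def distrib_right)
  \<comment> \<open>The bound \<open>n \<ge> 2\<close> puts the index 1 in range, so the second sum
    collapses to its term at \<open>k = 1\<close>.\<close>
  also have "\<dots> = ?y i + (if i = 0 then x * ?y 1 else 0)"
    using ij assms by (simp add: sum.distrib)
  also have "\<dots> = transvection n (x + y) $$ (i, j)"
    using ij assms by (auto simp: transvection_def add_ac)
  finally show "(transvection n x * transvection n y) $$ (i, j) = transvection n (x + y) $$ (i, j)" .
qed (auto simp: transvection_def)

lemma transvection_hom:
  assumes "n \<ge> 2"
  shows "transvection n \<in> hom (additive_monoid TYPE('a::comm_semiring_1)) (unitriangular_monoid TYPE('a) n)"
proof (rule homI)
  fix x y :: 'a
  show "transvection n x \<in> carrier (unitriangular_monoid TYPE('a) n)"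
    by (auto simp: transvection_def intro!: upper_triangularI)
  show "transvection n (x \<otimes>\<^bsub>additive_monoid TYPE('a)\<^esub> y) =
      transvection n x \<otimes>\<^bsub>unitriangular_monoid TYPE('a) n\<^esub> transvection n y"
    using transvection_mult[OF assms, of x y] by (simp add: additive_monoid_def)
qed

lemma inj_transvection:
  assumes "n \<ge> 2"
  shows "inj (transvection n :: 'a::comm_semiring_1 \<Rightarrow> 'a mat)"
proof (rule injI)
  fix x y :: 'a assume "transvection n x = transvection n y"
  then have "transvection n x $$ (0, 1) = transvection n y $$ (0, 1)" by simp
  then show "x = y" using assms by (simp add: transvection_def)
qed

section \<open>The equivalence\<close>

lemma FFM_additive_monoid_iff_unitriangular_monoid:
  assumes n: "n \<ge> 2"
  shows "FFM (unitriangular_monoid TYPE('a::information_semialgebra) n) \<longleftrightarrow>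
    FFM (additive_monoid TYPE('a))"
proof -
  let ?S = "additive_monoid TYPE('a)" and ?M = "unitriangular_monoid TYPE('a) n"
  note iffS = monoid.FFM_iff_finite_nontrivial_factorizations[OF monoid_additive_monoid Units_additive_monoid]
  note iffM = monoid.FFM_iff_finite_nontrivial_factorizations[OF monoid_unitriangular_monoid Units_unitriangular_monoid]
  show ?thesis
  proof
    assume M: "FFM ?M"
    have "finite (nontrivial_factorizations ?S x)" if x: "x \<in> carrier ?S" for x
    proof (rule finite_nontrivial_factorizations_inj_hom[OF monoid_additive_monoid _ transvection_hom[OF n]])
      show "inj_on (transvection n) (carrier ?S)"
        using inj_transvection[OF n] by (rule inj_on_subset) simp
      show "transvection n \<one>\<^bsub>?S\<^esub> = \<one>\<^bsub>?M\<^esub>"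
        by (auto simp: transvection_def additive_monoid_def)
      show "finite (nontrivial_factorizations ?M (transvection n x))"
        using M hom_in_carrier[OF transvection_hom[OF n] x] unfolding iffM by blast
    qed
    then show "FFM ?S" unfolding iffS by blast
  next
    assume "FFM ?S"
    then have "finite {as. 0 \<notin> set as \<and> sum_list as = x}" for x :: 'a
      unfolding iffS nontrivial_factorizations_additive_monoid by (simp add: additive_monoid_def)
    then show "FFM ?M"
      unfolding iffM using finite_nontrivial_factorizations_unitriangular by blast
  qed
qed

text \<open>For each \<open>n \<ge> 2\<close> the finite factorization property of the matrices is
  equivalent to a condition free of \<open>n\<close>, so it holds for all such \<open>n\<close> or
  for none; the range of \<open>n\<close> is nonempty.\<close>

theorem theorem4p16:
  assumes "reduced_semialgebra TYPE('a::information_semialgebra)"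
  shows "((\<forall>n\<ge>2. FFM (unitriangular_monoid TYPE('a) n)) \<longleftrightarrow>
          (\<exists>n\<ge>2. FFM (unitriangular_monoid TYPE('a) n))) \<and>
         ((\<exists>n\<ge>2. FFM (unitriangular_monoid TYPE('a) n)) \<longleftrightarrow>
          FFM (additive_monoid TYPE('a)))"
  using FFM_additive_monoid_iff_unitriangular_monoid by blast

end
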